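(* Let $\mathcal{X}=\{\mathbf{x}\in\mathbb{Z}^n: a_i\le x_i\le b_i\ \forall i\in N\}$, $N=\{1,\dots,n\}$, be a discrete hyperrectangle and let $h^i:\mathcal{X}\to\mathbb{R}$, $i\in N$. Let $H(\mathbf{x},\mathbf{y})=\max_{i\in N}\{h^i(\mathbf{x})-y_i\}$ on $\mathcal{X}\times\mathbb{R}^n_+$, with epigraph $$\mathcal{P}^H=\{(w,\mathbf{y},\mathbf{x})\in\mathbb{R}\times\mathbb{R}^n_+\times\mathcal{X}: w\ge h^i(\mathbf{x})-y_i\ \forall i\in N\}.$$ Let $\mathcal{U}=\{(u_0,\mathbf{u})\in\mathbb{R}^{n+1}_+:u_0\le\sum_{i\in N}u_i\}$, $g^j_i(\mathbf{x})=\max\{0,h^i(\mathbf{x})-h^j(\mathbf{x})\}$, and $F_{u_0,\mathbf{u}}(\mathbf{x})=\min_{j\in N}\{u_0h^j(\mathbf{x})+\sum_{i\in N}u_ig^j_i(\mathbf{x})\}$ on $\mathcal{X}$. Assume that $h^j$ and $g^j_i$ are L$^\natural$-convex for all $i,j\in N$. If $F_{u_0,\mathbf{u}}$ is L$^\natural$-convex for all $(u_0,\mathbf{u})\in\mathcal{U}$, then $\operatorname{conv}(\mathcal{P}^H)$, as a subset of $\mathbb{R}\times\mathbb{R}^n\times\overline{\mathcal{X}}$, is completely described by the mixed-integer SEPIs (MISEPIs) $$u_0w+\mathbf{u}^\top\mathbf{y}\ \ge\ F_{u_0,\mathbf{u}}(\mathbf{p})+\sum_{i=1}^n\Big[F_{u_0,\mathbf{u}}\Big(\mathbf{p}+\sum_{j=1}^{i}\mathbf{1}^{\delta(j)}\Big)-F_{u_0,\mathbf{u}}\Big(\mathbf{p}+\sum_{j=1}^{i-1}\mathbf{1}^{\delta(j)}\Big)\Big](x_{\delta(i)}-p_{\delta(i)})$$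 for all $(u_0,\mathbf{u})\in\mathcal{U}$, all $\mathbf{p}\in\underline{\mathcal{X}}$ and all permutations $\boldsymbol\delta$ of $N$.
   Context: $a_i,b_i\in\mathbb{Z}\cup\{\pm\infty\}$; $\overline{\mathcal{X}}=\{\mathbf{x}\in\mathbb{R}^n:a_i\le x_i\le b_i\ \forall i\}$; $\underline{\mathcal{X}}=\{\mathbf{x}\in\mathbb{Z}^n:a_i\le x_i\le b_i-1\ \forall i\}$ (with $\infty-1=\infty$). $f:\mathcal{X}\to\mathbb{R}$ is L$^\natural$-convex if $f(\mathbf{x})+f(\mathbf{y})\ge f(\lceil(\mathbf{x}+\mathbf{y})/2\rceil)+f(\lfloor(\mathbf{x}+\mathbf{y})/2\rfloor)$ for all $\mathbf{x},\mathbf{y}\in\mathcal{X}$ (component-wise rounding). $\mathbf{1}^i$ is the $i$-th unit vector. The right-hand side of the MISEPI is that of the shifted extremal polymatroid inequality (SEPI) associated with $\mathbf{p}$ and $\boldsymbol\delta$ for the epigraph of $F_{u_0,\mathbf{u}}$.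
   Formalization: The formal theorem assumes a_i < b_i for all i; if X is nonempty and some a_i = b_i, the set of admissible p is empty, there are no MISEPIs, and the claim as stated fails (e.g. n=1, a=b=0, h=0). *)

theory Defs
  imports "HOL-Analysis.Analysis"
begin

text \<open>
  The index set $N = \{1,\dots,n\}$ is a finite type \<^typ>\<open>'n\<close>, so $n$ is \<^term>\<open>CARD('n)\<close>.
  Functions on the discrete hyperrectangle are total functions on \<^typ>\<open>int ^ 'n\<close>;
  only their values on the hyperrectangle matter.
\<close>

definition extended_ints :: "ereal set" where
  "extended_ints = range (\<lambda>k::int. ereal (real_of_int k)) \<union> {\<infinity>, - \<infinity>}"

definition int_box :: "('n::finite \<Rightarrow> ereal) \<Rightarrow> ('n \<Rightarrow> ereal) \<Rightarrow> (int ^ 'n) set" where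
  "int_box a b = {x. \<forall>i. a i \<le> ereal (real_of_int (x $ i)) \<and> ereal (real_of_int (x $ i)) \<le> b i}"

definition real_box :: "('n::finite \<Rightarrow> ereal) \<Rightarrow> ('n \<Rightarrow> ereal) \<Rightarrow> (real ^ 'n) set" where
  "real_box a b = {x. \<forall>i. a i \<le> ereal (x $ i) \<and> ereal (x $ i) \<le> b i}"

text \<open>On \<^typ>\<open>ereal\<close> we have $\infty - 1 = \infty$.\<close>

definition lower_int_box :: "('n::finite \<Rightarrow> ereal) \<Rightarrow> ('n \<Rightarrow> ereal) \<Rightarrow> (int ^ 'n) set" where
  "lower_int_box a b = int_box a (\<lambda>i. b i - 1)"

definition L_natural_convex_on :: "(int ^ 'n::finite) set \<Rightarrow> (int ^ 'n \<Rightarrow> real) \<Rightarrow> bool" where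
  "L_natural_convex_on X f \<longleftrightarrow>
     (\<forall>x\<in>X. \<forall>y\<in>X. f x + f y \<ge>
        f (\<chi> i. \<lceil>real_of_int (x $ i + y $ i) / 2\<rceil>) + f (\<chi> i. \<lfloor>real_of_int (x $ i + y $ i) / 2\<rfloor>))"

definition real_vec :: "int ^ 'n::finite \<Rightarrow> real ^ 'n" where
  "real_vec x = (\<chi> i. real_of_int (x $ i))"

definition max_fun :: "('n::finite \<Rightarrow> int ^ 'n \<Rightarrow> real) \<Rightarrow> int ^ 'n \<Rightarrow> real ^ 'n \<Rightarrow> real" where
  "max_fun h x y = Max (range (\<lambda>i. h i x - y $ i))"

definition mixed_epigraph ::
    "(int ^ 'n::finite) set \<Rightarrow> ('n \<Rightarrow> int ^ 'n \<Rightarrow> real) \<Rightarrow> (real \<times> (real ^ 'n) \<times> (real ^ 'n)) set" where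
  "mixed_epigraph X h =
     {(w, y, real_vec x) | w y x. (\<forall>i. 0 \<le> y $ i) \<and> x \<in> X \<and> (\<forall>i. w \<ge> h i x - y $ i)}"

lemma mixed_epigraph_max_fun:
  "mixed_epigraph X h = {(w, y, real_vec x) | w y x. (\<forall>i. 0 \<le> y $ i) \<and> x \<in> X \<and> w \<ge> max_fun h x y}"
  by (simp add: mixed_epigraph_def max_fun_def)

definition weight_set :: "(real \<times> (real ^ 'n::finite)) set" where
  "weight_set = {(u0, u). 0 \<le> u0 \<and> (\<forall>i. 0 \<le> u $ i) \<and> u0 \<le> (\<Sum>i\<in>UNIV. u $ i)}"

definition gap_fun :: "('n::finite \<Rightarrow> int ^ 'n \<Rightarrow> real) \<Rightarrow> 'n \<Rightarrow> 'n \<Rightarrow> int ^ 'n \<Rightarrow> real" where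
  "gap_fun h j i x = max 0 (h i x - h j x)"

definition agg_fun ::
    "('n::finite \<Rightarrow> int ^ 'n \<Rightarrow> real) \<Rightarrow> real \<Rightarrow> real ^ 'n \<Rightarrow> int ^ 'n \<Rightarrow> real" where
  "agg_fun h u0 u x = Min (range (\<lambda>j. u0 * h j x + (\<Sum>i\<in>UNIV. u $ i * gap_fun h j i x)))"

text \<open>A permutation of $N$ is given as an enumeration $\delta(1),\dots,\delta(n)$ of the index type.\<close>

definition index_permutation :: "(nat \<Rightarrow> 'n::finite) \<Rightarrow> bool" where
  "index_permutation \<delta> \<longleftrightarrow> bij_betw \<delta> {1..CARD('n)} (UNIV :: 'n set)"

definition partial_shift :: "int ^ 'n::finite \<Rightarrow> (nat \<Rightarrow> 'n) \<Rightarrow> nat \<Rightarrow> int ^ 'n" where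
  "partial_shift p \<delta> i = p + (\<Sum>j=1..i. axis (\<delta> j) 1)"

definition sepi_rhs ::
    "(int ^ 'n::finite \<Rightarrow> real) \<Rightarrow> int ^ 'n \<Rightarrow> (nat \<Rightarrow> 'n) \<Rightarrow> real ^ 'n \<Rightarrow> real" where
  "sepi_rhs f p \<delta> x = f p +
     (\<Sum>i=1..CARD('n). (f (partial_shift p \<delta> i) - f (partial_shift p \<delta> (i - 1)))
        * (x $ \<delta> i - real_of_int (p $ \<delta> i)))"

end

theory Submission
  imports Defs
begin

text \<open>Over an integer point x the fibre of the epigraph is a polyhedron. Its vertices are the
  points \<open>epigraph_vertex h j x\<close>; its recession cone is the same for all x and has
  \<open>weight_set\<close> as dual cone. Hence F, that is \<open>agg_fun h u0 u\<close>, gives at x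
  the minimum of u0 * w + u \<bullet> y over the fibre (\<open>agg_fun_le\<close>,
  \<open>agg_fun_eq_vertex\<close>).

  The right-hand side of a SEPI is the affine interpolant of F on a chain from p to p + 1 of
  vertices of a unit cell. L-natural convexity makes it a minorant of F on the whole box
  (\<open>sepi_rhs_le\<close>), so the inequalities hold on the epigraph and, being linear, on its
  convex hull.

  Conversely, every x in the real box lies in a simplex spanned by such a chain, where the
  right-hand side is the matching convex combination of values of F
  (\<open>chain_combination_exists\<close>). This is the minimum of u0 * w + u \<bullet> y over the
  Minkowski combination of the fibres, a closed convex set inside the slice of the hull at x. Since
  the inequality holds for all weights in the dual cone, separation puts (w, y) into that set
  (\<open>mem_convex_hull_mixed_epigraph\<close>).\<close>

section \<open>Rounding and midpoints in the box\<close>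

text \<open>Integrality of the bounds keeps the interval from the floor of a coordinate to its
  successor inside the box.\<close>

lemma
  assumes "c \<in> extended_ints"
  shows extended_int_le_floor: "c \<le> ereal r \<Longrightarrow> c \<le> ereal (real_of_int \<lfloor>r\<rfloor>)"
    and extended_int_less_floor: "ereal r < c \<Longrightarrow> ereal (real_of_int (\<lfloor>r\<rfloor> + 1)) \<le> c"
proof -
  from assms consider k where "c = ereal (real_of_int k)" | "c = \<infinity>" | "c = -\<infinity>"
    by (auto simp: extended_ints_def)
  then have "(c \<le> ereal r \<longrightarrow> c \<le> ereal (real_of_int \<lfloor>r\<rfloor>)) \<and>
    (ereal r < c \<longrightarrow> ereal (real_of_int (\<lfloor>r\<rfloor> + 1)) \<le> c)"
  proof cases
    case 1
    then show ?thesis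
      by (simp add: le_floor_iff) (metis floor_less_iff of_int_1 of_int_add of_int_le_iff zless_imp_add1_zle)
  qed auto
  then show "c \<le> ereal r \<Longrightarrow> c \<le> ereal (real_of_int \<lfloor>r\<rfloor>)"
    and "ereal r < c \<Longrightarrow> ereal (real_of_int (\<lfloor>r\<rfloor> + 1)) \<le> c" by auto
qed

text \<open>Integer division instead of rounding of reals keeps the coordinate arguments within
  integer arithmetic.\<close>

definition up_mid :: "int ^ 'n::finite \<Rightarrow> int ^ 'n \<Rightarrow> int ^ 'n" where
  "up_mid x y = (\<chi> i. (x $ i + y $ i + 1) div 2)"

definition down_mid :: "int ^ 'n::finite \<Rightarrow> int ^ 'n \<Rightarrow> int ^ 'n" where
  "down_mid x y = (\<chi> i. (x $ i + y $ i) div 2)"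

lemma floor_half: "\<lfloor>real_of_int m / 2\<rfloor> = m div 2"
  using floor_divide_of_int_eq[of m 2] by simp

lemma ceiling_half: "\<lceil>real_of_int m / 2\<rceil> = (m + 1) div 2"
proof -
  have "\<lceil>real_of_int m / 2\<rceil> = - (- m div 2)"
    using ceiling_divide_eq_div[of m 2] by simp
  also have "\<dots> = (m + 1) div 2" by presburger
  finally show ?thesis .
qed

lemma L_natural_convex_on_mid:
  "L_natural_convex_on X f \<longleftrightarrow>
     (\<forall>x\<in>X. \<forall>y\<in>X. f (up_mid x y) + f (down_mid x y) \<le> f x + f y)"
  unfolding L_natural_convex_on_def up_mid_def down_mid_def ceiling_half floor_half ..

text \<open>This is why affine functions satisfy the midpoint inequality with equality, so that
  subtracting one preserves L-natural convexity.\<close>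

lemma up_mid_add_down_mid: "up_mid x y + down_mid x y = x + y"
proof -
  have "(m + 1) div 2 + m div 2 = m" for m :: int by presburger
  then show ?thesis by (simp add: vec_eq_iff up_mid_def down_mid_def)
qed

lemma int_box_between:
  assumes "x \<in> int_box a b" "y \<in> int_box a b"
    and "\<And>i. min (x $ i) (y $ i) \<le> z $ i" "\<And>i. z $ i \<le> max (x $ i) (y $ i)"
  shows "z \<in> int_box a b"
  unfolding int_box_def
proof (intro CollectI allI conjI)
  fix i
  have x: "a i \<le> ereal (x $ i)" "ereal (x $ i) \<le> b i"
    and y: "a i \<le> ereal (y $ i)" "ereal (y $ i) \<le> b i"
    using assms(1,2) by (auto simp: int_box_def)
  have "x $ i \<le> z $ i \<or> y $ i \<le> z $ i"
    using assms(3)[of i] by linarith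
  then show "a i \<le> ereal (z $ i)"
    using x y by (metis ereal_less_eq(3) of_int_le_iff order_trans)
  have "z $ i \<le> x $ i \<or> z $ i \<le> y $ i"
    using assms(4)[of i] by linarith
  then show "ereal (z $ i) \<le> b i"
    using x y by (metis ereal_less_eq(3) of_int_le_iff order_trans)
qed

lemma mid_in_int_box:
  assumes "x \<in> int_box a b" "y \<in> int_box a b"
  shows "up_mid x y \<in> int_box a b" "down_mid x y \<in> int_box a b"
proof -
  have "min k m \<le> (k + m + 1) div 2" "(k + m + 1) div 2 \<le> max k m"
    "min k m \<le> (k + m) div 2" "(k + m) div 2 \<le> max k m" for k m :: int
    by (auto simp: min_def max_def)
  then show "up_mid x y \<in> int_box a b" "down_mid x y \<in> int_box a b"
    by (auto intro!: int_box_between[OF assms] simp: up_mid_def down_mid_def)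
qed

section \<open>The chain of vertices of a unit cell\<close>

text \<open>By injectivity of \<open>\<delta>\<close>, coordinate \<open>\<delta> i\<close> is
  raised exactly once, at step \<open>i\<close>.\<close>

lemma partial_shift_nth:
  assumes "index_permutation (\<delta> :: nat \<Rightarrow> 'n::finite)" "i \<in> {1..CARD('n)}" "k \<le> CARD('n)"
  shows "partial_shift p \<delta> k $ \<delta> i = p $ \<delta> i + (if i \<le> k then 1 else 0)"
proof -
  have inj: "inj_on \<delta> {1..CARD('n)}"
    using assms(1) by (simp add: index_permutation_def bij_betw_def)
  have "(\<Sum>j=1..k. (axis (\<delta> j) 1 :: int ^ 'n) $ \<delta> i) = (\<Sum>j=1..k. if j = i then 1 else 0)"
  proof (rule sum.cong)
    fix j assume "j \<in> {1..k}"
    then have "\<delta> i = \<delta> j \<longleftrightarrow> i = j"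
      using assms(2,3) inj by (intro inj_on_eq_iff) auto
    then show "(axis (\<delta> j) 1 :: int ^ 'n) $ \<delta> i = (if j = i then 1 else 0)"
      by (auto simp: axis_def)
  qed simp
  also have "\<dots> = (if i \<le> k then 1 else 0)"
    using assms(2) by (subst sum.delta) auto
  finally show ?thesis
    unfolding partial_shift_def vector_add_component sum_component by simp
qed

lemma index_permutation_obtain:
  assumes "index_permutation (\<delta> :: nat \<Rightarrow> 'n::finite)"
  obtains j where "j \<in> {1..CARD('n)}" "i = \<delta> j"
proof -
  have "i \<in> \<delta> ` {1..CARD('n)}"
    using assms by (simp add: index_permutation_def bij_betw_def)
  then show thesis using that by blast
qed

lemma partial_shift_unit:
  assumes "index_permutation (\<delta> :: nat \<Rightarrow> 'n::finite)" "k \<le> CARD('n)"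
  shows "partial_shift p \<delta> k $ i = p $ i \<or> partial_shift p \<delta> k $ i = p $ i + 1"
proof -
  obtain j where "j \<in> {1..CARD('n)}" "i = \<delta> j"
    using index_permutation_obtain[OF assms(1)] .
  then show ?thesis using partial_shift_nth[OF assms(1) _ assms(2)] by auto
qed

lemma partial_shift_0: "partial_shift p \<delta> 0 = p"
  by (simp add: partial_shift_def)

lemma partial_shift_full:
  assumes "index_permutation (\<delta> :: nat \<Rightarrow> 'n::finite)"
  shows "partial_shift p \<delta> CARD('n) $ i = p $ i + 1"
proof -
  obtain j where "j \<in> {1..CARD('n)}" "i = \<delta> j"
    using index_permutation_obtain[OF assms(1)] .
  then show ?thesis using partial_shift_nth[OF assms, of j "CARD('n)"] by auto
qed

text \<open>The upper bound lowered by 1 leaves room for a unit step in every direction at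
  once.\<close>

lemma unit_cell_in_int_box:
  assumes "p \<in> lower_int_box a b" "\<And>i. q $ i = p $ i \<or> q $ i = p $ i + 1"
  shows "q \<in> int_box a b"
  unfolding int_box_def
proof (intro CollectI allI conjI)
  fix i
  have p: "a i \<le> ereal (p $ i)" "ereal (p $ i) \<le> b i - 1"
    using assms(1) by (auto simp: lower_int_box_def int_box_def)
  have "p $ i \<le> q $ i" "q $ i \<le> p $ i + 1"
    using assms(2)[of i] by auto
  then have q: "real_of_int (p $ i) \<le> q $ i" "real_of_int (q $ i) \<le> p $ i + 1"
    by linarith+
  show "a i \<le> ereal (q $ i)"
    using p(1) q(1) by (meson ereal_less_eq(3) order_trans)
  show "ereal (q $ i) \<le> b i"
    using p(2) q(2) by (cases "b i") (auto simp: one_ereal_def)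
qed

section \<open>The SEPI right-hand side as an affine minorant\<close>

text \<open>At the k-th chain vertex the factors are 1 up to index k and 0 beyond, and the
  differences telescope. So the right-hand side interpolates \<open>f\<close> on the chain.\<close>

lemma sepi_rhs_partial_shift:
  assumes "index_permutation (\<delta> :: nat \<Rightarrow> 'n::finite)" "k \<le> CARD('n)"
  shows "sepi_rhs f p \<delta> (real_vec (partial_shift p \<delta> k)) = f (partial_shift p \<delta> k)"
proof -
  let ?v = "partial_shift p \<delta>"
  have "(\<Sum>i=1..CARD('n). (f (?v i) - f (?v (i - 1))) *
          (real_vec (?v k) $ \<delta> i - real_of_int (p $ \<delta> i)))
      = (\<Sum>i=1..CARD('n). if i \<in> {1..k} then f (?v i) - f (?v (i - 1)) else 0)"
    using assms by (intro sum.cong) (auto simp: real_vec_def partial_shift_nth)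
  also have "\<dots> = (\<Sum>i=1..k. f (?v i) - f (?v (i - 1)))"
    using assms(2) by (subst sum.inter_restrict[symmetric]) (auto intro!: sum.cong)
  also have "\<dots> = (\<Sum>i<k. f (?v (Suc i)) - f (?v i))"
    by (rule sum.reindex_bij_witness[of _ Suc "\<lambda>i. i - 1"]) auto
  also have "\<dots> = f (?v k) - f (?v 0)"
    by (rule sum_lessThan_telescope)
  finally show ?thesis by (simp add: sepi_rhs_def partial_shift_0)
qed

text \<open>Affinity in the form that combines with \<open>up_mid_add_down_mid\<close>.\<close>

lemma sepi_rhs_affine:
  fixes x y z t :: "real ^ 'n::finite"
  assumes "x + y = z + t"
  shows "sepi_rhs f p \<delta> x + sepi_rhs f p \<delta> y = sepi_rhs f p \<delta> z + sepi_rhs f p \<delta> t"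
proof -
  have eq: "x $ i + y $ i = z $ i + t $ i" for i
    using assms by (metis vector_add_component)
  have "c * (x $ i - r) + c * (y $ i - r) = c * (z $ i - r) + c * (t $ i - r)" for c r i
  proof -
    have "(x $ i - r) + (y $ i - r) = (z $ i - r) + (t $ i - r)" using eq[of i] by simp
    then show ?thesis unfolding distrib_left[symmetric] by (rule arg_cong)
  qed
  then have "(\<Sum>i=1..CARD('n). c i * (x $ \<delta> i - r i)) + (\<Sum>i=1..CARD('n). c i * (y $ \<delta> i - r i))
      = (\<Sum>i=1..CARD('n). c i * (z $ \<delta> i - r i)) + (\<Sum>i=1..CARD('n). c i * (t $ \<delta> i - r i))"
    for c r unfolding sum.distrib[symmetric] by (intro sum.cong refl)
  from this[of "\<lambda>i. f (partial_shift p \<delta> i) - f (partial_shift p \<delta> (i - 1))" "\<lambda>i. p $ \<delta> i"]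
  show ?thesis
    unfolding sepi_rhs_def by linarith
qed

text \<open>
  Subtracting the affine right-hand side leaves a function \<open>g\<close> that still satisfies the midpoint
  inequality and vanishes on the chain. Inside the unit cell the midpoint inequality is
  submodularity, and completing a vertex along the chain does not increase \<open>g\<close>; other points
  are pulled into the cell by taking midpoints with \<open>p + 1\<close> and \<open>p\<close>.
\<close>
lemma sepi_rhs_le:
  fixes f :: "int ^ 'n::finite \<Rightarrow> real"
  assumes L: "L_natural_convex_on (int_box a b) f"
    and p: "p \<in> lower_int_box a b" and d: "index_permutation \<delta>"
    and q: "q \<in> int_box a b"
  shows "sepi_rhs f p \<delta> (real_vec q) \<le> f q"
proof -
  let ?v = "partial_shift p \<delta>" and ?n = "CARD('n)"
  define g where "g x = f x - sepi_rhs f p \<delta> (real_vec x)" for x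
  have mid: "g (up_mid x y) + g (down_mid x y) \<le> g x + g y"
    if "x \<in> int_box a b" "y \<in> int_box a b" for x y
  proof -
    have "real_vec (up_mid x y) + real_vec (down_mid x y) = real_vec x + real_vec y"
      using up_mid_add_down_mid[of x y]
      by (simp add: vec_eq_iff real_vec_def flip: of_int_add)
    from sepi_rhs_affine[OF this, of f p \<delta>] that L show ?thesis
      unfolding L_natural_convex_on_mid g_def by fastforce
  qed
  have chain: "g (?v k) = 0" if "k \<le> ?n" for k
    using sepi_rhs_partial_shift[OF d that] by (simp add: g_def)
  have chain_in: "?v k \<in> int_box a b" if "k \<le> ?n" for k
    using unit_cell_in_int_box[OF p] partial_shift_unit[OF d that] by blast
  have cell: "0 \<le> g x" if x: "\<And>i. x $ i = p $ i \<or> x $ i = p $ i + 1" for x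
  proof -
    \<comment> \<open>The join of \<open>x\<close> with the k-th chain vertex: a path from
      \<open>x\<close> to p + 1 along which \<open>g\<close> does not increase.\<close>
    define s where "s k = (\<chi> i. max (x $ i) (?v k $ i))" for k
    have le: "g (s k) \<le> g x" if "k \<le> ?n" for k
      using that
    proof (induction k)
      case 0
      have "s 0 = x"
        by (simp add: s_def vec_eq_iff partial_shift_0 max_def) (metis x less_add_one not_le)
      then show ?case by simp
    next
      case (Suc k)
      have u: "s k $ i = p $ i \<or> s k $ i = p $ i + 1" for i
        using x[of i] partial_shift_unit[OF d, of k p i] Suc.prems by (auto simp: s_def)
      \<comment> \<open>Within a unit cell, rounding up and down gives join and meet. The meet here
        is a chain vertex, where \<open>g\<close> vanishes.\<close>
      have up: "up_mid (s k) (?v (Suc k)) = s (Suc k)"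
        and down: "down_mid (s k) (?v (Suc k)) = (if x $ \<delta> (Suc k) = p $ \<delta> (Suc k) then ?v k else ?v (Suc k))"
      proof -
        have "up_mid (s k) (?v (Suc k)) $ i = s (Suc k) $ i \<and>
          down_mid (s k) (?v (Suc k)) $ i = (if x $ \<delta> (Suc k) = p $ \<delta> (Suc k) then ?v k else ?v (Suc k)) $ i" for i
        proof -
          obtain j where j: "j \<in> {1..?n}" "i = \<delta> j"
            using index_permutation_obtain[OF d] .
          have v: "?v k $ i = p $ i + (if j \<le> k then 1 else 0)"
            "?v (Suc k) $ i = p $ i + (if j \<le> Suc k then 1 else 0)"
            using partial_shift_nth[OF d j(1)] Suc.prems j(2) by auto
          consider "j \<le> k" | "j = Suc k" | "j > Suc k" by linarith
          then show ?thesis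
            by cases (use x[of i] v j(2) in \<open>auto simp: up_mid_def down_mid_def s_def max_def\<close>)
        qed
        then show "up_mid (s k) (?v (Suc k)) = s (Suc k)"
          and "down_mid (s k) (?v (Suc k)) = (if x $ \<delta> (Suc k) = p $ \<delta> (Suc k) then ?v k else ?v (Suc k))"
          unfolding vec_eq_iff by blast+
      qed
      have "g (s (Suc k)) + 0 \<le> g (s k) + 0"
        using mid[OF unit_cell_in_int_box[OF p u] chain_in[OF Suc.prems]] up down
          chain[OF Suc.prems] chain[of k] Suc.prems by (auto split: if_splits)
      then show ?case using Suc by simp
    qed
    have "x $ i \<le> p $ i + 1" for i using x[of i] by auto
    then have "s ?n = ?v ?n"
      by (simp add: s_def vec_eq_iff partial_shift_full[OF d] max_absorb2)
    then show ?thesis using le[of ?n] chain[of ?n] by simp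
  qed
  \<comment> \<open>As \<open>g p = 0\<close>, nonnegativity at both midpoints with \<open>p\<close>
    passes to \<open>x\<close>. These midpoints reduce the distance to \<open>p\<close> only while
    it exceeds 1, since rounding can preserve a deviation of 1; hence the offset in
    \<open>1 + int m\<close>.\<close>
  have near: "0 \<le> g x" if "x \<in> int_box a b" "\<And>i. \<bar>x $ i - p $ i\<bar> \<le> 1 + int m" for m x
    using that
  proof (induction m arbitrary: x)
    case 0
    \<comment> \<open>Midpoints with p + 1 send the deviations -1, 0 and 1 into the cell, which
      midpoints with \<open>p\<close> need not do.\<close>
    let ?w = "?v ?n"
    have "up_mid x ?w $ i = p $ i \<or> up_mid x ?w $ i = p $ i + 1"
      "down_mid x ?w $ i = p $ i \<or> down_mid x ?w $ i = p $ i + 1" for i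
      using 0(2)[of i] by (auto simp: up_mid_def down_mid_def partial_shift_full[OF d])
    then have "0 \<le> g (up_mid x ?w)" "0 \<le> g (down_mid x ?w)"
      by (auto intro: cell)
    then show ?case using mid[OF 0(1) chain_in[of ?n]] chain[of ?n] by simp
  next
    case (Suc m)
    have pin: "p \<in> int_box a b" using unit_cell_in_int_box[OF p] by blast
    have "\<bar>up_mid x p $ i - p $ i\<bar> \<le> 1 + int m" "\<bar>down_mid x p $ i - p $ i\<bar> \<le> 1 + int m" for i
      using Suc.prems(2)[of i] by (auto simp: up_mid_def down_mid_def)
    then have "0 \<le> g (up_mid x p)" "0 \<le> g (down_mid x p)"
      using Suc.IH mid_in_int_box[OF Suc.prems(1) pin] by blast+
    moreover have "g p = 0" using chain[of 0] by (simp add: partial_shift_0)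
    ultimately show ?case using mid[OF Suc.prems(1) pin] by simp
  qed
  define m where "m = nat (Max (range (\<lambda>i. \<bar>q $ i - p $ i\<bar>)))"
  have "\<bar>q $ i - p $ i\<bar> \<le> 1 + int m" for i
  proof -
    have "\<bar>q $ i - p $ i\<bar> \<le> Max (range (\<lambda>i. \<bar>q $ i - p $ i\<bar>))" by (rule Max_ge) auto
    then show ?thesis unfolding m_def by linarith
  qed
  then have "0 \<le> g q" using near q by blast
  then show ?thesis by (simp add: g_def)
qed

section \<open>F as a lower bound on the fibres\<close>

text \<open>
  As a function of \<open>w\<close>, the bound \<open>u0 * w + (\<Sum>i. u $ i * max 0 (h i x - w))\<close> is convex and piecewise
  linear with breakpoints \<open>h j x\<close>; its slope at \<open>w\<close> tells in which direction the next breakpoint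
  is at least as good.
\<close>
lemma agg_fun_le:
  fixes h :: "'n::finite \<Rightarrow> int ^ 'n \<Rightarrow> real"
  assumes u: "(u0, u) \<in> weight_set" and y: "\<And>i. 0 \<le> y $ i" "\<And>i. h i x - y $ i \<le> w"
  shows "agg_fun h u0 u x \<le> u0 * w + u \<bullet> y"
proof -
  \<comment> \<open>\<open>A\<close> collects the breakpoints to the right of \<open>w\<close>, so
    \<open>s\<close> is the right-hand slope at \<open>w\<close>.\<close>
  define A where "A = {i. w < h i x}"
  define s where "s = u0 - (\<Sum>i\<in>A. u $ i)"
  have u0: "0 \<le> u0" and ui: "\<And>i. 0 \<le> u $ i" and us: "u0 \<le> (\<Sum>i\<in>UNIV. u $ i)"
    using u by (auto simp: weight_set_def)
  \<comment> \<open>The last two conditions say that no breakpoint lies strictly between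
    \<open>w\<close> and \<open>h j x\<close>. The function is thus linear there with slope
    \<open>s\<close>, and the first condition says that moving to \<open>h j x\<close> does not
    increase it.\<close>
  have split: "agg_fun h u0 u x \<le> u0 * w + u \<bullet> y"
    if sj: "s * (h j x - w) \<le> 0" and above: "\<And>i. i \<in> A \<Longrightarrow> h j x \<le> h i x"
      and below: "\<And>i. i \<notin> A \<Longrightarrow> h i x \<le> h j x" for j
  proof -
    have "agg_fun h u0 u x \<le> u0 * h j x + (\<Sum>i\<in>UNIV. u $ i * gap_fun h j i x)"
      unfolding agg_fun_def by (rule Min_le) auto
    also have "(\<Sum>i\<in>UNIV. u $ i * gap_fun h j i x) = (\<Sum>i\<in>UNIV. if i \<in> A then u $ i * (h i x - h j x) else 0)"
      using above below by (intro sum.cong) (auto simp: gap_fun_def max_absorb1 max_absorb2)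
    also have "\<dots> = (\<Sum>i\<in>A. u $ i * (h i x - h j x))"
      by (subst sum.inter_restrict[symmetric]) auto
    also have "u0 * h j x + (\<Sum>i\<in>A. u $ i * (h i x - h j x))
        = u0 * w + (\<Sum>i\<in>A. u $ i * (h i x - w)) + s * (h j x - w)"
      by (simp add: s_def algebra_simps sum_subtractf sum_distrib_left sum_distrib_right sum.distrib)
    also have "\<dots> \<le> u0 * w + (\<Sum>i\<in>A. u $ i * (h i x - w))"
      using sj by simp
    also have "(\<Sum>i\<in>A. u $ i * (h i x - w)) \<le> (\<Sum>i\<in>A. u $ i * y $ i)"
      using y(2) ui by (intro sum_mono mult_left_mono) (auto simp: algebra_simps)
    also have "\<dots> \<le> (\<Sum>i\<in>UNIV. u $ i * y $ i)"
      using ui y(1) by (intro sum_mono2) auto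
    also have "\<dots> = u \<bullet> y" by (simp add: inner_vec_def)
    finally show ?thesis by simp
  qed
  show ?thesis
  \<comment> \<open>Move left to the nearest breakpoint if the slope permits and one exists,
    otherwise right.\<close>
  proof (cases "0 \<le> s \<and> A \<noteq> UNIV")
    case True
    then have ne: "- A \<noteq> {}" by auto
    have "Max ((\<lambda>i. h i x) ` (- A)) \<in> (\<lambda>i. h i x) ` (- A)" using ne by (intro Max_in) auto
    then obtain j where j: "j \<notin> A" "h j x = Max ((\<lambda>i. h i x) ` (- A))" by auto
    show ?thesis
    proof (rule split[of j])
      show "s * (h j x - w) \<le> 0"
        using True j(1) by (auto simp: A_def intro!: mult_nonneg_nonpos)
      show "h j x \<le> h i x" if "i \<in> A" for i using that j(1) by (auto simp: A_def)
      show "h i x \<le> h j x" if "i \<notin> A" for i using that by (auto simp: j(2))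
    qed
  next
    case False
    \<comment> \<open>If \<open>A = UNIV\<close>, then \<open>s \<le> 0\<close> is the weight
      condition on \<open>u0\<close>; if \<open>s < 0\<close>, then \<open>A\<close> is nonempty
      because \<open>u0\<close> is nonnegative.\<close>
    have ne: "A \<noteq> {}" and s: "s \<le> 0"
      using False u0 us by (auto simp: s_def)
    have "Min ((\<lambda>i. h i x) ` A) \<in> (\<lambda>i. h i x) ` A" using ne by (intro Min_in) auto
    then obtain j where j: "j \<in> A" "h j x = Min ((\<lambda>i. h i x) ` A)" by auto
    show ?thesis
    proof (rule split[of j])
      show "s * (h j x - w) \<le> 0"
        using s j(1) by (auto simp: A_def intro!: mult_nonpos_nonneg)
      show "h i x \<le> h j x" if "i \<notin> A" for i using that j(1) by (auto simp: A_def)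
      show "h j x \<le> h i x" if "i \<in> A" for i using that by (auto simp: j(2))
    qed
  qed
qed

section \<open>Real boxes, summation by parts, and cells\<close>

lemma convex_real_box: "convex (real_box a b :: (real ^ 'n::finite) set)"
  unfolding convex_def
proof (intro ballI allI impI)
  fix x y :: "real ^ 'n" and u v :: real
  assume x: "x \<in> real_box a b" and y: "y \<in> real_box a b" and uv: "0 \<le> u" "0 \<le> v" "u + v = 1"
  show "u *\<^sub>R x + v *\<^sub>R y \<in> real_box a b"
    unfolding real_box_def
  proof (intro CollectI allI conjI)
    fix i
    let ?z = "(u *\<^sub>R x + v *\<^sub>R y) $ i"
    have xi: "a i \<le> ereal (x $ i)" "ereal (x $ i) \<le> b i"
      and yi: "a i \<le> ereal (y $ i)" "ereal (y $ i) \<le> b i"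
      using x y by (auto simp: real_box_def)
    have "min (x $ i) (y $ i) \<le> ?z" "?z \<le> max (x $ i) (y $ i)"
      using convex_bound_le[of "x $ i" "max (x $ i) (y $ i)" "y $ i" u v]
        convex_bound_le[of "- (x $ i)" "- min (x $ i) (y $ i)" "- (y $ i)" u v] uv by auto
    then show "a i \<le> ereal ?z" "ereal ?z \<le> b i"
      using xi yi by (metis ereal_less_eq(3) min_def order_trans, metis ereal_less_eq(3) max_def order_trans)
  qed
qed

text \<open>Summation by parts. For nonincreasing \<open>T\<close> the left side is a convex
  combination; the right side is the shape of \<open>sepi_rhs\<close>.\<close>

lemma abel_sum_weights:
  fixes \<phi> :: "nat \<Rightarrow> 'a::real_vector"
  assumes "T (Suc n) = 0" "T 0 = 1"
  shows "(\<Sum>k\<le>n. (T k - T (Suc k)) *\<^sub>R \<phi> k) = \<phi> 0 + (\<Sum>k=1..n. T k *\<^sub>R (\<phi> k - \<phi> (k - 1)))"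
proof -
  \<comment> \<open>The boundary term makes the induction go through and vanishes at
    \<open>m = n\<close>.\<close>
  have "(\<Sum>k\<le>m. (T k - T (Suc k)) *\<^sub>R \<phi> k) + T (Suc m) *\<^sub>R \<phi> m
      = T 0 *\<^sub>R \<phi> 0 + (\<Sum>k=1..m. T k *\<^sub>R (\<phi> k - \<phi> (k - 1)))" for m
    by (induction m) (simp_all add: algebra_simps)
  from this[of n] show ?thesis using assms by simp
qed

text \<open>Sorting the offsets of a point within its cell selects a chain whose simplex contains
  it.\<close>

lemma antitone_index_permutation_exists:
  fixes t :: "'n::finite \<Rightarrow> real"
  obtains \<delta> where "index_permutation \<delta>"
    "\<And>i j. 1 \<le> i \<Longrightarrow> i \<le> j \<Longrightarrow> j \<le> CARD('n) \<Longrightarrow> t (\<delta> j) \<le> t (\<delta> i)"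
proof -
  obtain ys :: "'n list" where ys: "set ys = UNIV" "distinct ys"
    using finite_distinct_list[OF finite_class.finite_UNIV] by blast
  define xs where "xs = sort_key (\<lambda>i. - t i) ys"
  have xs: "set xs = UNIV" "distinct xs" "sorted (map (\<lambda>i. - t i) xs)"
    using ys by (auto simp: xs_def)
  then have len: "length xs = CARD('n)" by (metis distinct_card)
  show thesis
  proof (rule that[of "\<lambda>i. xs ! (i - 1)"])
    have "bij_betw (\<lambda>i. i - 1) {1..CARD('n)} {..<CARD('n)}"
      by (rule bij_betwI[of _ _ _ Suc]) auto
    from bij_betw_trans[OF this bij_betw_nth[OF xs(2), of "{..<CARD('n)}" UNIV]]
    show "index_permutation (\<lambda>i. xs ! (i - 1))"
      using xs len by (simp add: index_permutation_def comp_def)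
    fix i j :: nat assume ij: "1 \<le> i" "i \<le> j" "j \<le> CARD('n)"
    then have "map (\<lambda>i. - t i) xs ! (i - 1) \<le> map (\<lambda>i. - t i) xs ! (j - 1)"
      using len by (intro sorted_nth_mono[OF xs(3)]) auto
    then show "t (xs ! (j - 1)) \<le> t (xs ! (i - 1))"
      using ij len by simp
  qed
qed

text \<open>The corner is the coordinatewise floor, except where a coordinate attains its upper
  bound. There it is one lower, which \<open>a i < b i\<close> and integrality allow.\<close>

lemma lower_int_box_cell_exists:
  fixes x :: "real ^ 'n::finite"
  assumes "\<And>i. a i \<in> extended_ints" "\<And>i. b i \<in> extended_ints" "\<And>i. a i < b i"
    and x: "x \<in> real_box a b"
  obtains p where "p \<in> lower_int_box a b"
    "\<And>i. real_of_int (p $ i) \<le> x $ i" "\<And>i. x $ i \<le> p $ i + 1"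
proof -
  have ex: "\<exists>k::int. a i \<le> ereal k \<and> ereal k \<le> b i - 1 \<and> real_of_int k \<le> x $ i \<and> x $ i \<le> k + 1" for i
  proof -
    have xi: "a i \<le> ereal (x $ i)" "ereal (x $ i) \<le> b i"
      using x by (auto simp: real_box_def)
    have to_lower: "ereal k \<le> b i - 1" if "ereal (k + 1) \<le> b i" for k :: real
      using that by (cases "b i") (auto simp: one_ereal_def)
    show ?thesis
    proof (cases "ereal (x $ i) = b i")
      case False
      with xi have "ereal (x $ i) < b i" by simp
      then show ?thesis
        using extended_int_le_floor[OF assms(1) xi(1)] extended_int_less_floor[OF assms(2), of "x $ i" i]
          to_lower[of "real_of_int \<lfloor>x $ i\<rfloor>"]
        by (intro exI[of _ "\<lfloor>x $ i\<rfloor>"]) auto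
    next
      case True
      then obtain m :: int where m: "b i = ereal m" "x $ i = m"
        using assms(2)[of i] by (auto simp: extended_ints_def)
      have "a i \<le> ereal (m - 1)"
        using assms(1)[of i] assms(3)[of i] m by (auto simp: extended_ints_def)
      then show ?thesis using m to_lower[of "m - 1"]
        by (intro exI[of _ "m - 1"]) auto
    qed
  qed
  then obtain k :: "'n \<Rightarrow> int" where k: "\<And>i. a i \<le> ereal (k i) \<and> ereal (k i) \<le> b i - 1 \<and>
      real_of_int (k i) \<le> x $ i \<and> x $ i \<le> k i + 1" by metis
  then show thesis
    by (intro that[of "\<chi> i. k i"]) (auto simp: lower_int_box_def int_box_def)
qed

section \<open>Vertices and recession cone of the fibres\<close>

definition epigraph_recession :: "(real \<times> (real ^ 'n::finite)) set" where
  "epigraph_recession = {(w, y). (\<forall>i. 0 \<le> y $ i) \<and> (\<forall>i. 0 \<le> w + y $ i)}"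

text \<open>The point of the fibre with \<open>w = h j x\<close> and the least possible
  \<open>y\<close>. Pairing it with (u0, u) gives the j-th term of the minimum in
  \<open>agg_fun\<close>.\<close>

definition epigraph_vertex :: "('n::finite \<Rightarrow> int ^ 'n \<Rightarrow> real) \<Rightarrow> 'n \<Rightarrow> int ^ 'n \<Rightarrow> real \<times> (real ^ 'n)" where
  "epigraph_vertex h j x = (h j x, \<chi> i. gap_fun h j i x)"

lemma closed_epigraph_recession: "closed (epigraph_recession :: (real \<times> (real ^ 'n::finite)) set)"
proof -
  have eq: "(epigraph_recession :: (real \<times> (real ^ 'n)) set) =
    (\<Inter>i. {z. 0 \<le> snd z $ i}) \<inter> (\<Inter>i. {z. 0 \<le> fst z + snd z $ i})"
    by (auto simp: epigraph_recession_def)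
  show ?thesis unfolding eq
    by (intro closed_Int closed_INT ballI closed_Collect_le continuous_intros)
qed

lemma convex_epigraph_recession: "convex (epigraph_recession :: (real \<times> (real ^ 'n::finite)) set)"
proof (rule convexI)
  fix c d :: "real \<times> (real ^ 'n)" and s t :: real
  assume *: "c \<in> epigraph_recession" "d \<in> epigraph_recession" "0 \<le> s" "0 \<le> t"
  then have "0 \<le> s * (fst c + snd c $ i) + t * (fst d + snd d $ i)
      \<and> 0 \<le> s * (snd c $ i) + t * (snd d $ i)" for i
    by (intro conjI add_nonneg_nonneg[OF mult_nonneg_nonneg mult_nonneg_nonneg])
      (auto simp: epigraph_recession_def)
  then show "s *\<^sub>R c + t *\<^sub>R d \<in> epigraph_recession"
    by (simp add: epigraph_recession_def case_prod_unfold algebra_simps)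
qed

text \<open>Three kinds of ray suffice: raising \<open>w\<close>, raising one \<open>y $ i\<close>,
  and lowering \<open>w\<close> while raising all \<open>y $ i\<close> equally.\<close>

lemma epigraph_recession_dual:
  fixes u :: "real ^ 'n::finite"
  assumes "\<And>c. c \<in> epigraph_recession \<Longrightarrow> 0 \<le> (u0, u) \<bullet> c"
  shows "(u0, u) \<in> weight_set"
proof -
  have "0 \<le> u0" using assms[of "(1, 0)"] by (simp add: epigraph_recession_def)
  moreover have "0 \<le> u $ i" for i
    using assms[of "(0, axis i 1)"] by (simp add: epigraph_recession_def inner_axis) (simp add: axis_def)
  moreover have "u0 \<le> (\<Sum>i\<in>UNIV. u $ i)"
    using assms[of "(- 1, \<chi> i. 1)"] by (simp add: epigraph_recession_def inner_vec_def)
  ultimately show ?thesis by (simp add: weight_set_def)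
qed

lemma agg_fun_eq_vertex:
  obtains j where "agg_fun h u0 u x = (u0, u) \<bullet> epigraph_vertex h j x"
proof -
  have "agg_fun h u0 u x \<in> range (\<lambda>j. u0 * h j x + (\<Sum>i\<in>UNIV. u $ i * gap_fun h j i x))"
    unfolding agg_fun_def by (rule Min_in) auto
  then show thesis using that by (auto simp: epigraph_vertex_def inner_vec_def)
qed

lemma epigraph_vertex_mem:
  assumes "x \<in> X"
  shows "(fst (epigraph_vertex h j x), snd (epigraph_vertex h j x), real_vec x) \<in> mixed_epigraph X h"
proof -
  have "h i x - max 0 (h i x - h j x) \<le> h j x" for i by linarith
  then show ?thesis
    using assms by (auto simp: mixed_epigraph_def epigraph_vertex_def gap_fun_def)
qed

text \<open>Translation by a recession direction maps the epigraph into itself and commutes with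
  taking hulls.\<close>

lemma convex_hull_mixed_epigraph_recession:
  assumes "(w, y, x) \<in> convex hull (mixed_epigraph X h)" "(w', y') \<in> epigraph_recession"
  shows "(w + w', y + y', x) \<in> convex hull (mixed_epigraph X h)"
proof -
  let ?c = "(w', y', 0)"
  have "(+) ?c ` mixed_epigraph X h \<subseteq> mixed_epigraph X h"
  proof (rule image_subsetI)
    fix z assume "z \<in> mixed_epigraph X h"
    then obtain w1 y1 x1 where z: "z = (w1, y1, x1)" "(w1, y1, x1) \<in> mixed_epigraph X h"
      by (cases z) auto
    from z(2) obtain q where q: "x1 = real_vec q" "q \<in> X" "\<forall>i. 0 \<le> y1 $ i" "\<forall>i. h i q - y1 $ i \<le> w1"
      by (auto simp: mixed_epigraph_def)
    have "h i q - (y' + y1) $ i \<le> w' + w1" for i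
    proof -
      have "0 \<le> w' + y' $ i" using assms(2) by (simp add: epigraph_recession_def)
      moreover have "h i q - y1 $ i \<le> w1" using q by blast
      ultimately show ?thesis by simp
    qed
    then show "?c + z \<in> mixed_epigraph X h"
      using z(1) q assms(2) by (auto simp: mixed_epigraph_def epigraph_recession_def)
  qed
  from hull_mono[OF this, of convex]
  have "(+) ?c ` (convex hull (mixed_epigraph X h)) \<subseteq> convex hull (mixed_epigraph X h)"
    by (simp add: convex_hull_translation)
  moreover have "(w + w', y + y', x) = ?c + (w, y, x)" by (simp add: add.commute)
  ultimately show ?thesis using assms(1) by (metis image_subset_iff)
qed

section \<open>Separation and membership in the hull\<close>

text \<open>The sum of a compact convex set and a closed convex cone is closed and convex, so a
  point outside is strictly separated from it. The separating functional is bounded below on the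
  cone, hence nonnegative there, and \<open>dual\<close> contradicts the separation.\<close>

lemma mem_compact_plus_cone:
  fixes z :: "'a::euclidean_space"
  assumes E: "compact E" "convex E" "E \<noteq> {}" and C: "closed C" "convex C" "cone C" "C \<noteq> {}"
    and dual: "\<And>u. (\<And>c. c \<in> C \<Longrightarrow> 0 \<le> u \<bullet> c) \<Longrightarrow> \<exists>e\<in>E. u \<bullet> e \<le> u \<bullet> z"
  shows "\<exists>e\<in>E. \<exists>c\<in>C. z = e + c"
proof (rule ccontr)
  assume contra: "\<not> ?thesis"
  define K where "K = (\<Union>e\<in>E. \<Union>c\<in>C. {e + c})"
  have "closed K" unfolding K_def by (rule compact_closed_sums) (use E C in auto)
  moreover have "convex K" unfolding K_def by (rule convex_sums) (use E C in auto)
  moreover have "z \<notin> K" using contra by (auto simp: K_def)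
  ultimately obtain u r where u: "u \<bullet> z < r" "\<And>k. k \<in> K \<Longrightarrow> r < u \<bullet> k"
    using separating_hyperplane_closed_point[of K z] by auto
  obtain e0 where e0: "e0 \<in> E" using E by blast
  have "0 \<le> u \<bullet> c" if c: "c \<in> C" for c
  proof (rule ccontr)
    assume "\<not> 0 \<le> u \<bullet> c"
    then have neg: "u \<bullet> c < 0" by simp
    \<comment> \<open>Far enough along \<open>c\<close> for the functional to drop to
      \<open>r\<close> or below; the maximum with 0 keeps the multiple in the cone.\<close>
    define t where "t = max 0 ((r - u \<bullet> e0) / (u \<bullet> c))"
    have "t *\<^sub>R c \<in> C" using C(3) c by (simp add: cone_def t_def)
    then have "r < u \<bullet> (e0 + t *\<^sub>R c)" using u(2) e0 by (auto simp: K_def)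
    then have 1: "r - u \<bullet> e0 < t * (u \<bullet> c)" by (simp add: inner_right_distrib)
    have "(r - u \<bullet> e0) / (u \<bullet> c) \<le> t" by (simp add: t_def)
    then have "t * (u \<bullet> c) \<le> r - u \<bullet> e0" using neg by (simp add: field_simps)
    with 1 show False by simp
  qed
  then obtain e where e: "e \<in> E" "u \<bullet> e \<le> u \<bullet> z" using dual by blast
  have "0 \<in> C" using C(3,4) by (simp add: cone_contains_0)
  then have "e + 0 \<in> K" using e(1) by (auto simp only: K_def)
  from u(2)[OF this] u(1) e(2) show False by simp
qed

lemma convex_slice:
  fixes S :: "('a::real_vector \<times> 'b::real_vector \<times> 'c::real_vector) set"
  shows "convex S \<Longrightarrow> convex {(w, y). (w, y, x) \<in> S}"
proof (rule convexI)
  fix c d :: "'a \<times> 'b" and s t :: real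
  assume S: "convex S" and mem: "c \<in> {(w, y). (w, y, x) \<in> S}" "d \<in> {(w, y). (w, y, x) \<in> S}"
    and st: "0 \<le> s" "0 \<le> t" "s + t = 1"
  have "s *\<^sub>R x + t *\<^sub>R x = x" using st(3) by (simp flip: scaleR_left_distrib)
  moreover have "(fst c, snd c, x) \<in> S" "(fst d, snd d, x) \<in> S" using mem by auto
  note convexD[OF S this st]
  ultimately show "s *\<^sub>R c + t *\<^sub>R d \<in> {(w, y). (w, y, x) \<in> S}"
    by (simp add: case_prod_unfold)
qed

text \<open>
  Writing \<open>x\<close> as a convex combination of a chain \<open>v\<close> of cell vertices, the inequalities attached to
  this chain say that \<open>(w, y)\<close> is not separated from the corresponding Minkowski combination of
  the fibres of the epigraph over \<open>v k\<close>. This combination is closed because all the fibres have the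
  same recession cone.
\<close>
lemma mem_convex_hull_mixed_epigraph:
  fixes h :: "'n::finite \<Rightarrow> int ^ 'n \<Rightarrow> real" and n :: nat
  assumes l: "\<And>k. k \<le> n \<Longrightarrow> 0 \<le> l k" "(\<Sum>k\<le>n. l k) = 1"
    and v: "\<And>k. k \<le> n \<Longrightarrow> v k \<in> X" and x: "x = (\<Sum>k\<le>n. l k *\<^sub>R real_vec (v k))"
    and ineq: "\<And>u0 u. (u0, u) \<in> weight_set \<Longrightarrow>
      (\<Sum>k\<le>n. l k * agg_fun h u0 u (v k)) \<le> u0 * w + u \<bullet> y"
  shows "(w, y, x) \<in> convex hull (mixed_epigraph X h)"
proof -
  let ?H = "convex hull (mixed_epigraph X h)"
  \<comment> \<open>\<open>pt j\<close> combines one chosen vertex per fibre. Extensional choice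
    functions form a finite set, which makes \<open>E\<close> compact.\<close>
  define pt where "pt j = (\<Sum>k\<le>n. l k *\<^sub>R epigraph_vertex h (j k) (v k))" for j
  define E where "E = convex hull (pt ` ({..n} \<rightarrow>\<^sub>E UNIV))"
  have fin: "finite (pt ` ({..n} \<rightarrow>\<^sub>E UNIV))" by (intro finite_imageI finite_PiE) auto
  have slice: "E \<subseteq> {(w, y). (w, y, x) \<in> ?H}"
    unfolding E_def
  proof (rule hull_minimal)
    show "convex {(w, y). (w, y, x) \<in> ?H}" by (rule convex_slice) simp
    show "pt ` ({..n} \<rightarrow>\<^sub>E UNIV) \<subseteq> {(w, y). (w, y, x) \<in> ?H}"
    proof safe
      fix j and w' :: real and y' :: "real ^ 'n" assume "(w', y') = pt j"
      then have wy: "w' = fst (pt j)" "y' = snd (pt j)" by (metis fst_conv, metis snd_conv)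
      let ?e = "\<lambda>k. epigraph_vertex h (j k) (v k)"
      have "(\<Sum>k\<le>n. l k *\<^sub>R (fst (?e k), snd (?e k), real_vec (v k))) \<in> ?H"
        using l v by (intro convex_sum hull_inc epigraph_vertex_mem) auto
      also have "(\<Sum>k\<le>n. l k *\<^sub>R (fst (?e k), snd (?e k), real_vec (v k))) = (w', y', x)"
        unfolding wy x pt_def by (simp add: prod_eq_iff fst_sum snd_sum)
      finally show "(w', y', x) \<in> ?H" .
    qed
  qed
  have "\<exists>e\<in>E. \<exists>c\<in>epigraph_recession. (w, y) = e + c"
  proof (rule mem_compact_plus_cone)
    show "compact E" unfolding E_def by (rule finite_imp_compact_convex_hull[OF fin])
    show "convex E" by (simp add: E_def)
    show "E \<noteq> {}" by (simp add: E_def PiE_eq_empty_iff)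
    show "cone (epigraph_recession :: (real \<times> (real ^ 'n)) set)"
      by (auto simp: cone_def epigraph_recession_def simp flip: distrib_left)
    have "0 \<in> (epigraph_recession :: (real \<times> (real ^ 'n)) set)"
      by (simp add: epigraph_recession_def zero_prod_def)
    then show "(epigraph_recession :: (real \<times> (real ^ 'n)) set) \<noteq> {}" by blast
    fix U :: "real \<times> (real ^ 'n)"
    assume U: "\<And>c. c \<in> epigraph_recession \<Longrightarrow> 0 \<le> U \<bullet> c"
    obtain u0 u where Uu: "U = (u0, u)" by (cases U)
    have W: "(u0, u) \<in> weight_set" using U unfolding Uu by (rule epigraph_recession_dual)
    \<comment> \<open>Minimising \<open>U\<close> separately in each fibre yields one point of
      \<open>E\<close> at which \<open>U\<close> equals the weighted sum of values of F.\<close>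
    have "\<forall>k. \<exists>j. agg_fun h u0 u (v k) = U \<bullet> epigraph_vertex h j (v k)"
      unfolding Uu using agg_fun_eq_vertex by metis
    then obtain j where j: "\<And>k. agg_fun h u0 u (v k) = U \<bullet> epigraph_vertex h (j k) (v k)" by metis
    have "pt (restrict j {..n}) \<in> E"
      unfolding E_def by (intro hull_inc imageI) (simp only: restrict_PiE_iff UNIV_I ball_UNIV simp_thms, simp)
    moreover have "U \<bullet> pt (restrict j {..n}) = (\<Sum>k\<le>n. l k * agg_fun h u0 u (v k))"
      by (simp add: pt_def inner_sum_right j)
    ultimately show "\<exists>e\<in>E. U \<bullet> e \<le> U \<bullet> (w, y)"
      using ineq[OF W] Uu by (intro bexI[of _ "pt (restrict j {..n})"]) simp_all
  qed (rule closed_epigraph_recession convex_epigraph_recession)+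
  then obtain w1 y1 w2 y2 where *: "(w1, y1) \<in> E" "(w2, y2) \<in> epigraph_recession"
    "w = w1 + w2" "y = y1 + y2" by auto
  then show ?thesis
    using slice convex_hull_mixed_epigraph_recession[of w1 y1 x X h w2 y2] by auto
qed

section \<open>Barycentric coordinates along a chain\<close>

lemma real_vec_partial_shift_Suc:
  "real_vec (partial_shift p \<delta> (Suc k)) - real_vec (partial_shift p \<delta> k) = axis (\<delta> (Suc k)) 1"
proof -
  have "partial_shift p \<delta> (Suc k) = partial_shift p \<delta> k + axis (\<delta> (Suc k)) 1"
    by (simp add: partial_shift_def)
  then show ?thesis
    by (simp add: vec_eq_iff real_vec_def axis_def)
qed

text \<open>The differences of successive sorted offsets are the barycentric coordinates of
  \<open>x\<close>. They do not depend on \<open>f\<close>, so the same weights serve every SEPI on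
  this chain.\<close>

lemma chain_combination_exists:
  fixes x :: "real ^ 'n::finite"
  assumes "\<And>i. real_of_int (p $ i) \<le> x $ i" "\<And>i. x $ i \<le> p $ i + 1"
  obtains \<delta> l where "index_permutation \<delta>" "\<And>k. k \<le> CARD('n) \<Longrightarrow> 0 \<le> l k"
    "(\<Sum>k\<le>CARD('n). l k) = 1"
    "x = (\<Sum>k\<le>CARD('n). l k *\<^sub>R real_vec (partial_shift p \<delta> k))"
    "\<And>f. sepi_rhs f p \<delta> x = (\<Sum>k\<le>CARD('n). l k * f (partial_shift p \<delta> k))"
proof -
  let ?n = "CARD('n)"
  define t where "t i = x $ i - p $ i" for i
  have t: "0 \<le> t i" "t i \<le> 1" for i
    using assms[of i] by (auto simp: t_def)
  obtain \<delta> where d: "index_permutation \<delta>"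
    and anti: "\<And>i j. 1 \<le> i \<Longrightarrow> i \<le> j \<Longrightarrow> j \<le> ?n \<Longrightarrow> t (\<delta> j) \<le> t (\<delta> i)"
    using antitone_index_permutation_exists[of t] by blast
  \<comment> \<open>The end values 1 and 0 enclose the offsets, so all differences are nonnegative
    and sum to 1.\<close>
  define T where "T k = (if k = 0 then 1 else if k \<le> ?n then t (\<delta> k) else 0)" for k
  have T: "T (Suc ?n) = 0" "T 0 = 1" by (simp_all add: T_def)
  show thesis
  proof (rule that[OF d, of "\<lambda>k. T k - T (Suc k)"])
    show "0 \<le> T k - T (Suc k)" if "k \<le> ?n" for k
      using t anti[of k "Suc k"] that by (auto simp: T_def)
    show "(\<Sum>k\<le>?n. T k - T (Suc k)) = 1"
      using abel_sum_weights[OF T, of "\<lambda>_. 1 :: real"] by simp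
    show "sepi_rhs f p \<delta> x = (\<Sum>k\<le>?n. (T k - T (Suc k)) * f (partial_shift p \<delta> k))" for f
      using abel_sum_weights[OF T, of "\<lambda>k. f (partial_shift p \<delta> k)"]
      by (simp add: sepi_rhs_def partial_shift_0 T_def t_def mult.commute)
    have "(\<Sum>k\<le>?n. (T k - T (Suc k)) *\<^sub>R real_vec (partial_shift p \<delta> k))
      = real_vec p + (\<Sum>k=1..?n. T k *\<^sub>R
          (real_vec (partial_shift p \<delta> k) - real_vec (partial_shift p \<delta> (k - 1))))"
      using abel_sum_weights[OF T, of "\<lambda>k. real_vec (partial_shift p \<delta> k)"]
      by (simp add: partial_shift_0)
    also have "(\<Sum>k=1..?n. T k *\<^sub>R
          (real_vec (partial_shift p \<delta> k) - real_vec (partial_shift p \<delta> (k - 1))))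
        = (\<Sum>k=1..?n. t (\<delta> k) *\<^sub>R axis (\<delta> k) 1)"
    proof (rule sum.cong)
      fix k assume "k \<in> {1..?n}"
      then show "T k *\<^sub>R (real_vec (partial_shift p \<delta> k) - real_vec (partial_shift p \<delta> (k - 1)))
          = t (\<delta> k) *\<^sub>R axis (\<delta> k) 1"
        using real_vec_partial_shift_Suc[of p \<delta> "k - 1"] by (simp add: T_def)
    qed simp
    also have "\<dots> = (\<Sum>i\<in>UNIV. t i *\<^sub>R axis i 1)"
      using d unfolding index_permutation_def by (rule sum.reindex_bij_betw)
    also have "real_vec p + \<dots> = x"
      by (simp add: vec_eq_iff real_vec_def t_def axis_def if_distrib cong: if_cong)
    finally show "x = (\<Sum>k\<le>?n. (T k - T (Suc k)) *\<^sub>R real_vec (partial_shift p \<delta> k))" ..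
  qed
qed

section \<open>Both inclusions\<close>

lemma convex_sepi_halfspace:
  "convex {(w, y, x). sepi_rhs f p \<delta> x \<le> u0 * w + u \<bullet> y}"
  unfolding convex_alt
proof (clarsimp)
  fix w y x w' y' x' and s :: real
  assume a: "sepi_rhs f p \<delta> x \<le> u0 * w + u \<bullet> y" "sepi_rhs f p \<delta> x' \<le> u0 * w' + u \<bullet> y'" "0 \<le> s" "s \<le> 1"
  have "sepi_rhs f p \<delta> ((1 - s) *\<^sub>R x + s *\<^sub>R x') = (1 - s) * sepi_rhs f p \<delta> x + s * sepi_rhs f p \<delta> x'"
    unfolding sepi_rhs_def distrib_left sum_distrib_left
    by (simp add: algebra_simps flip: sum.distrib sum_subtractf)
  also have "\<dots> \<le> (1 - s) * (u0 * w + u \<bullet> y) + s * (u0 * w' + u \<bullet> y')"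
    using a by (intro add_mono mult_left_mono) auto
  finally show "sepi_rhs f p \<delta> ((1 - s) *\<^sub>R x + s *\<^sub>R x') \<le>
      u0 * ((1 - s) * w + s * w') + u \<bullet> ((1 - s) *\<^sub>R y + s *\<^sub>R y')"
    by (simp add: algebra_simps)
qed

theorem corollary5p12:
  fixes a b :: "'n::finite \<Rightarrow> ereal"
    and h :: "'n \<Rightarrow> int ^ 'n \<Rightarrow> real"
  assumes "\<And>i. a i \<in> extended_ints" and "\<And>i. b i \<in> extended_ints"
    and "\<And>i. a i < b i"
    and "\<And>j. L_natural_convex_on (int_box a b) (h j)"
    and "\<And>i j. L_natural_convex_on (int_box a b) (gap_fun h j i)"
    and "\<And>u0 u. (u0, u) \<in> weight_set \<Longrightarrow> L_natural_convex_on (int_box a b) (agg_fun h u0 u)"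
  shows "convex hull (mixed_epigraph (int_box a b) h) =
    {(w, y, x). x \<in> real_box a b \<and>
       (\<forall>(u0, u) \<in> weight_set. \<forall>p \<in> lower_int_box a b. \<forall>\<delta>. index_permutation \<delta> \<longrightarrow>
          u0 * w + u \<bullet> y \<ge> sepi_rhs (agg_fun h u0 u) p \<delta> x)}"
    (is "?H = ?R")
proof
  \<comment> \<open>By convexity only points of the epigraph itself matter; there the interpolant is
    at most F, and F is at most the left-hand side.\<close>
  have valid: "?H \<subseteq> {(w, y, x). sepi_rhs (agg_fun h u0 u) p \<delta> x \<le> u0 * w + u \<bullet> y}"
    if "(u0, u) \<in> weight_set" "p \<in> lower_int_box a b" "index_permutation \<delta>" for u0 u p \<delta>
  proof (rule hull_minimal[where S = convex, OF _ convex_sepi_halfspace])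
    show "mixed_epigraph (int_box a b) h \<subseteq> {(w, y, x). sepi_rhs (agg_fun h u0 u) p \<delta> x \<le> u0 * w + u \<bullet> y}"
    proof
      fix z assume "z \<in> mixed_epigraph (int_box a b) h"
      then obtain w y q where z: "z = (w, y, real_vec q)" and "q \<in> int_box a b"
        and "\<And>i. 0 \<le> y $ i" "\<And>i. h i q - y $ i \<le> w"
        by (auto simp: mixed_epigraph_def)
      then have "agg_fun h u0 u q \<le> u0 * w + u \<bullet> y"
        using agg_fun_le[OF that(1)] by blast
      with sepi_rhs_le[OF assms(6)[OF that(1)] that(2,3) \<open>q \<in> int_box a b\<close>]
      show "z \<in> {(w, y, x). sepi_rhs (agg_fun h u0 u) p \<delta> x \<le> u0 * w + u \<bullet> y}"
        by (simp add: z)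
    qed
  qed
  have box: "?H \<subseteq> UNIV \<times> UNIV \<times> real_box a b"
  proof (rule hull_minimal)
    show "mixed_epigraph (int_box a b) h \<subseteq> UNIV \<times> UNIV \<times> real_box a b"
      by (auto simp: mixed_epigraph_def real_box_def int_box_def real_vec_def)
  qed (intro convex_Times convex_UNIV convex_real_box)
  show "?H \<subseteq> ?R"
  proof
    fix z assume z: "z \<in> ?H"
    obtain w y x where [simp]: "z = (w, y, x)" by (cases z)
    have "sepi_rhs (agg_fun h u0 u) p \<delta> x \<le> u0 * w + u \<bullet> y"
      if "(u0, u) \<in> weight_set" "p \<in> lower_int_box a b" "index_permutation \<delta>" for u0 u p \<delta>
      using subsetD[OF valid[OF that] z] by simp
    moreover have "x \<in> real_box a b" using subsetD[OF box z] by simp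
    ultimately show "z \<in> ?R" by auto
  qed
  show "?R \<subseteq> ?H"
  proof
    fix z assume "z \<in> ?R"
    then obtain w y x where z: "z = (w, y, x)" and x: "x \<in> real_box a b"
      and ineq: "\<forall>(u0, u) \<in> weight_set. \<forall>p \<in> lower_int_box a b. \<forall>\<delta>. index_permutation \<delta> \<longrightarrow>
          u0 * w + u \<bullet> y \<ge> sepi_rhs (agg_fun h u0 u) p \<delta> x" by (cases z) auto
    \<comment> \<open>Both \<open>p\<close> and \<open>\<delta>\<close> are chosen from
      \<open>x\<close> alone, so a single chain serves all weights simultaneously.\<close>
    obtain p where p: "p \<in> lower_int_box a b" "\<And>i. real_of_int (p $ i) \<le> x $ i" "\<And>i. x $ i \<le> p $ i + 1"
      using lower_int_box_cell_exists[OF assms(1-3) x] by blast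
    obtain \<delta> l where d: "index_permutation \<delta>" and l: "\<And>k. k \<le> CARD('n) \<Longrightarrow> 0 \<le> l k"
      "(\<Sum>k\<le>CARD('n). l k) = 1"
      and xl: "x = (\<Sum>k\<le>CARD('n). l k *\<^sub>R real_vec (partial_shift p \<delta> k))"
      and rhs: "\<And>f. sepi_rhs f p \<delta> x = (\<Sum>k\<le>CARD('n). l k * f (partial_shift p \<delta> k))"
      using chain_combination_exists[OF p(2,3)] by blast
    show "z \<in> ?H"
      unfolding z
    proof (rule mem_convex_hull_mixed_epigraph[OF l _ xl])
      show "partial_shift p \<delta> k \<in> int_box a b" if "k \<le> CARD('n)" for k
        using unit_cell_in_int_box[OF p(1)] partial_shift_unit[OF d that] by blast
      show "(\<Sum>k\<le>CARD('n). l k * agg_fun h u0 u (partial_shift p \<delta> k)) \<le> u0 * w + u \<bullet> y"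
        if "(u0, u) \<in> weight_set" for u0 u
      proof -
        have "sepi_rhs (agg_fun h u0 u) p \<delta> x \<le> u0 * w + u \<bullet> y"
          using bspec[OF ineq that] p(1) d by simp
        then show ?thesis by (simp add: rhs)
      qed
    qed
  qed
qed

end
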